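(* Let $\mathbf{O}=\mathbf{O}(\mathbb{R})$ be the split-octonion algebra over the field $\mathbb{R}$ of real numbers, and let $c\in\mathbf{O}$. Let $X\subseteq\mathbf{O}$ be the set of all solutions of the equation $x^3=c$, where $x\in\mathbf{O}$ is a variable. 1. Assume $c=\gamma1_{\mathbf{O}}$ for some $\gamma\in\mathbb{R}$. Then $$X=\big\{\sqrt[3]{\gamma}\,1_{\mathbf{O}}\big\}\cup O\big(-\sqrt[3]{\gamma},-\sqrt[3]{\gamma^2}\big).$$ 2. Assume $c\notin\mathbb{R}1_{\mathbf{O}}$ and $\mathrm{tr}(c)\neq0$. Then $x\in X$ if and only if there exists $\lambda\in\mathbb{R}$ satisfying $$\left\{\begin{array}{rcl}\big(2\lambda^3+\mathrm{tr}(c)\big)^2\big(\lambda^3-4\,\mathrm{tr}(c)\big)&=&27\lambda^3\big(4n(c)-\mathrm{tr}(c)^2\big),\\ 2\lambda^3+\mathrm{tr}(c)&\neq&0,\end{array}\right.$$ such that $$x=\frac{3\lambda}{2\lambda^3+\mathrm{tr}(c)}\bigg(c-\frac{\mathrm{tr}(c)}{2}1_{\mathbf{O}}\bigg)+\frac{\lambda}{2}1_{\mathbf{O}}.$$ 3. Assume $c\notin\mathbb{R}1_{\mathbf{O}}$ and $\mathrm{tr}(c)=0$. (a) If $n(c)>0$, then $X=\{x_1,x_2\}$. (b) If $n(c)=0$, then $X=\emptyset$. (c) If $n(c)<0$, then $X=\{x_1\}$, where $$x_1=-\frac{c}{\sqrt[3]{n(c)}},\qquad x_2=\frac12\bigg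(\frac{c}{\sqrt[3]{n(c)}}+\sqrt{3}\,\sqrt[6]{n(c)}\,1_{\mathbf{O}}\bigg).$$
   Context: The split-octonion algebra $\mathbf{O}=\mathbf{O}(\mathbb{R})$ is the $8$-dimensional real vector space of all matrices $a=\begin{pmatrix}\alpha&\mathbf{u}\\ \mathbf{v}&\beta\end{pmatrix}$ with $\alpha,\beta\in\mathbb{R}$ and vectors $\mathbf{u},\mathbf{v}\in\mathbb{R}^3$, with multiplication $$aa'=\begin{pmatrix}\alpha\alpha'+\mathbf{u}\cdot\mathbf{v}'&\alpha\mathbf{u}'+\beta'\mathbf{u}-\mathbf{v}\times\mathbf{v}'\\ \alpha'\mathbf{v}+\beta\mathbf{v}'+\mathbf{u}\times\mathbf{u}'&\beta\beta'+\mathbf{v}\cdot\mathbf{u}'\end{pmatrix},\qquad a'=\begin{pmatrix}\alpha'&\mathbf{u}'\\ \mathbf{v}'&\beta'\end{pmatrix},$$ where $\cdot$ and $\times$ are the usual dot and cross products on $\mathbb{R}^3$. The unity $1_{\mathbf{O}}$ is the element with $\alpha=\beta=1$, $\mathbf{u}=\mathbf{v}=\mathbf{0}$. The trace is $\mathrm{tr}(a)=\alpha+\beta$ and the norm is $n(a)=\alpha\beta-\mathbf{u}\cdot\mathbf{v}$. The algebra is alternative, hence power-associative, so $x^3$ is well defined. $\mathrm{Aut}(\mathbf{O})$ is the group of all automorphisms of the algebra $\mathbf{O}$. For $\lambda,\mu\in\mathbb{R}$, $O(\lambda,\mu)$ denotes the $\mathrm{Aut}(\mathbf{O})$-orbit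 of $\begin{pmatrix}\lambda&(\mu,0,0)\\(1,0,0)&0\end{pmatrix}$. $\sqrt[3]{\cdot}$ is the real cube root, and $\sqrt[6]{\cdot}$ is the usual sixth root of a non-negative real number.
   Formalization: In 3(a) the solution set is corrected to {x_1, x_2, x_3} with x_3 = (1/2)(c/∛n(c) − √3·n(c)^{1/6}·1), since the printed {x_1, x_2} omits this third solution (e.g. α=β=0, u=e_1, v=−e_1). *)

theory Defs
  imports "HOL-Analysis.Analysis"
begin

unbundle cross3_syntax

text \<open>
  The tuple \<open>(\<alpha>, u, v, \<beta>)\<close> stands for the Zorn vector matrix with diagonal \<open>\<alpha>, \<beta>\<close>,
  upper right entry \<open>u\<close> and lower left entry \<open>v\<close>.  The real vector space structure is the
  componentwise one of the product type.
\<close>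

type_synonym split_octonion = "real \<times> (real^3) \<times> (real^3) \<times> real"

definition oct_mult :: "split_octonion \<Rightarrow> split_octonion \<Rightarrow> split_octonion"  (infixl \<open>\<odot>\<close> 70)
  where "a \<odot> a' = (case a of (\<alpha>, u, v, \<beta>) \<Rightarrow> case a' of (\<alpha>', u', v', \<beta>') \<Rightarrow>
    (\<alpha> * \<alpha>' + u \<bullet> v',
     \<alpha> *\<^sub>R u' + \<beta>' *\<^sub>R u - (v \<times> v'),
     \<alpha>' *\<^sub>R v + \<beta> *\<^sub>R v' + (u \<times> u'),
     \<beta> * \<beta>' + v \<bullet> u'))"

definition oct_one :: split_octonion  (\<open>\<one>\<^sub>O\<close>)
  where "\<one>\<^sub>O = (1, 0, 0, 1)"

definition oct_tr :: "split_octonion \<Rightarrow> real"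
  where "oct_tr a = (case a of (\<alpha>, u, v, \<beta>) \<Rightarrow> \<alpha> + \<beta>)"

definition oct_norm :: "split_octonion \<Rightarrow> real"
  where "oct_norm a = (case a of (\<alpha>, u, v, \<beta>) \<Rightarrow> \<alpha> * \<beta> - u \<bullet> v)"

definition oct_scalars :: "split_octonion set"
  where "oct_scalars = range (\<lambda>\<gamma>. \<gamma> *\<^sub>R \<one>\<^sub>O)"

definition oct_cube :: "split_octonion \<Rightarrow> split_octonion"
  where "oct_cube x = (x \<odot> x) \<odot> x"

lemma oct_cube_right: "oct_cube x = x \<odot> (x \<odot> x)"
  by (cases x)
    (simp add: oct_cube_def oct_mult_def cross_add_left cross_add_right cross_mult_left
      cross_mult_right inner_commute algebra_simps)

definition oct_Aut :: "(split_octonion \<Rightarrow> split_octonion) set"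
  where "oct_Aut = {f. linear f \<and> bij f \<and> (\<forall>a b. f (a \<odot> b) = f a \<odot> f b)}"

definition oct_orbit :: "real \<Rightarrow> real \<Rightarrow> split_octonion set"
  where "oct_orbit lam mu =
    (\<lambda>f. f (lam, vector [mu, 0, 0], vector [1, 0, 0], 0)) ` oct_Aut"

text \<open>
  For \<open>tr(c) = 0\<close> and \<open>n(c) > 0\<close> the subalgebra spanned by \<open>1\<close> and \<open>c\<close> is a copy of the complex
  numbers, so \<open>x\<^sup>3 = c\<close> has three solutions.  The published list contains only two of them: in the
  second one, the square root of 3 must be taken with both signs.  The following instance shows
  that the third solution cannot be dropped.
\<close>

lemma oct_third_cube_root:
  fixes c :: split_octonion
  defines "c \<equiv> (0, vector [1, 0, 0], vector [-1, 0, 0], 0)"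
  shows "c \<notin> oct_scalars" and "oct_tr c = 0" and "oct_norm c = 1"
    and "{x. oct_cube x = c} \<noteq>
      {- (1 / root 3 (oct_norm c)) *\<^sub>R c,
       (1/2) *\<^sub>R ((1 / root 3 (oct_norm c)) *\<^sub>R c + (sqrt 3 * root 6 (oct_norm c)) *\<^sub>R \<one>\<^sub>O)}"
proof -
  have z: "vector [-1, 0, 0] = - (vector [1, 0, 0] :: real^3)"
    by (simp add: vec_eq_iff forall_3)
  have nz: "(vector [1, 0, 0] :: real^3) \<noteq> 0"
    by (simp add: vec_eq_iff forall_3)
  have i: "(vector [1, 0, 0] :: real^3) \<bullet> vector [1, 0, 0] = 1"
    by (simp add: inner_vec_def sum_3)
  show "c \<notin> oct_scalars"
    using nz by (auto simp: oct_scalars_def c_def oct_one_def)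
  show "oct_tr c = 0"
    by (simp add: oct_tr_def c_def)
  show n: "oct_norm c = 1"
    by (simp add: oct_norm_def c_def z i)
  define y where "y = (1/2) *\<^sub>R (c - sqrt 3 *\<^sub>R \<one>\<^sub>O)"
  have y: "y = (- sqrt 3 / 2, (1/2) *\<^sub>R vector [1, 0, 0], - (1/2) *\<^sub>R vector [1, 0, 0], - sqrt 3 / 2)"
    by (simp add: y_def c_def oct_one_def z)
  have yy: "y \<odot> y = (1/2, (- sqrt 3 / 2) *\<^sub>R vector [1, 0, 0], (sqrt 3 / 2) *\<^sub>R vector [1, 0, 0], 1/2)"
    by (simp add: y oct_mult_def i cross_mult_left cross_mult_right)
      (simp add: vec_eq_iff forall_3)
  have "oct_cube y = c"
    by (simp add: oct_cube_def yy)
      (simp add: y oct_mult_def i c_def z cross_mult_left cross_mult_right vec_eq_iff forall_3)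
  moreover have "y \<noteq> - c"
    by (simp add: y c_def z)
  moreover have "y \<noteq> (1/2) *\<^sub>R (c + sqrt 3 *\<^sub>R \<one>\<^sub>O)"
    by (simp add: y c_def z oct_one_def)
  ultimately show "{x. oct_cube x = c} \<noteq>
      {- (1 / root 3 (oct_norm c)) *\<^sub>R c,
       (1/2) *\<^sub>R ((1 / root 3 (oct_norm c)) *\<^sub>R c + (sqrt 3 * root 6 (oct_norm c)) *\<^sub>R \<one>\<^sub>O)}"
    by (auto simp: n)
qed

end

theory Submission
  imports Defs
begin

text \<open>
  Every \<open>x\<close> satisfies \<open>x\<^sup>2 = tr(x) x - n(x) 1\<close>, hence \<open>x\<^sup>3 = (tr(x)\<^sup>2 - n(x)) x - tr(x) n(x) 1\<close>.
  So a cube root of a non-scalar \<open>c\<close> is an affine function of \<open>c\<close>, and taking the trace and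
  the norm of \<open>x\<^sup>3 = c\<close> determines its coefficients.  For scalar \<open>c\<close> the non-scalar cube roots
  are the non-scalar elements with a prescribed trace and norm.  These form a single orbit:
  exponentials of nilpotent derivations, the swap of the diagonal and the natural action of
  \<open>SL\<^sub>3\<close> bring every non-scalar element into the normal form used to define \<open>O(\<lambda>, \<mu>)\<close>, for which
  \<open>\<lambda>\<close> is the trace and \<open>-\<mu>\<close> the norm.
\<close>

subsection \<open>Trace, norm and powers\<close>

lemma oct_tr_add [simp]: "oct_tr (a + b) = oct_tr a + oct_tr b"
  by (cases a; cases b) (simp add: oct_tr_def)

lemma oct_tr_diff [simp]: "oct_tr (a - b) = oct_tr a - oct_tr b"
  by (cases a; cases b) (simp add: oct_tr_def)

lemma oct_tr_scaleR [simp]: "oct_tr (r *\<^sub>R a) = r * oct_tr a"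
  by (cases a) (simp add: oct_tr_def algebra_simps)

lemma oct_tr_one [simp]: "oct_tr \<one>\<^sub>O = 2"
  by (simp add: oct_tr_def oct_one_def)

text \<open>The norm is a quadratic form whose polar form pairs \<open>a\<close> with the unity to
  \<open>oct_tr a\<close>.\<close>

lemma oct_norm_affine:
  "oct_norm (r *\<^sub>R a + s *\<^sub>R \<one>\<^sub>O) = r\<^sup>2 * oct_norm a + r * s * oct_tr a + s\<^sup>2"
  by (cases a) (simp add: oct_norm_def oct_tr_def oct_one_def algebra_simps power2_eq_square)

lemma oct_mult_one_left [simp]: "\<one>\<^sub>O \<odot> a = a"
  by (cases a) (simp add: oct_one_def oct_mult_def)

lemma oct_mult_one_right [simp]: "a \<odot> \<one>\<^sub>O = a"
  by (cases a) (simp add: oct_one_def oct_mult_def)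

lemma oct_mult_affine_left: "(r *\<^sub>R a + s *\<^sub>R b) \<odot> d = r *\<^sub>R (a \<odot> d) + s *\<^sub>R (b \<odot> d)"
  by (cases a; cases b; cases d)
    (simp add: oct_mult_def cross_add_left cross_mult_left inner_add_left algebra_simps)

lemma oct_square: "a \<odot> a = oct_tr a *\<^sub>R a + (- oct_norm a) *\<^sub>R \<one>\<^sub>O"
  by (cases a) (simp add: oct_mult_def oct_tr_def oct_norm_def oct_one_def inner_commute algebra_simps)

lemma oct_cube_eq:
  "oct_cube x = ((oct_tr x)\<^sup>2 - oct_norm x) *\<^sub>R x + (- (oct_tr x * oct_norm x)) *\<^sub>R \<one>\<^sub>O"
proof -
  have "oct_cube x = oct_tr x *\<^sub>R (x \<odot> x) + (- oct_norm x) *\<^sub>R x"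
    unfolding oct_cube_def by (subst oct_square[of x], subst oct_mult_affine_left) simp
  then show ?thesis
    by (simp add: oct_square algebra_simps power2_eq_square)
qed

text \<open>If p and q are the roots of X^2 - tr(x) X + n(x), the right-hand side is the power sum
  p^3 + q^3.\<close>

lemma oct_tr_cube: "oct_tr (oct_cube x) = (oct_tr x)^3 - 3 * oct_tr x * oct_norm x"
  by (simp add: oct_cube_eq) algebra

lemma oct_norm_cube: "oct_norm (oct_cube x) = (oct_norm x)^3"
  by (simp only: oct_cube_eq oct_norm_affine) algebra

lemma oct_scalars_iff: "a \<in> oct_scalars \<longleftrightarrow> (\<exists>r. a = r *\<^sub>R \<one>\<^sub>O)"
  by (auto simp: oct_scalars_def)

lemma scaleR_one_in_oct_scalars [simp]: "r *\<^sub>R \<one>\<^sub>O \<in> oct_scalars"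
  by (auto simp: oct_scalars_def)

lemma scaleR_oct_one_eq_iff [simp]: "r *\<^sub>R \<one>\<^sub>O = s *\<^sub>R \<one>\<^sub>O \<longleftrightarrow> r = s"
  by (simp add: oct_one_def)

text \<open>A non-scalar \<open>a\<close> and the unity are linearly independent. This permits
  comparing coefficients in \<open>oct_square\<close> and \<open>oct_cube_eq\<close>.\<close>

lemma oct_affine_unique:
  assumes "a \<notin> oct_scalars" and eq: "r *\<^sub>R a + s *\<^sub>R \<one>\<^sub>O = r' *\<^sub>R a + s' *\<^sub>R \<one>\<^sub>O"
  shows "r = r'" and "s = s'"
proof -
  have *: "(r - r') *\<^sub>R a = (s' - s) *\<^sub>R \<one>\<^sub>O"
    using eq by (simp add: algebra_simps)
  show "r = r'"
  proof (rule ccontr)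
    assume "r \<noteq> r'"
    then have "a = (inverse (r - r')) *\<^sub>R ((r - r') *\<^sub>R a)"
      by simp
    then have "a = (inverse (r - r') * (s' - s)) *\<^sub>R \<one>\<^sub>O"
      unfolding * by simp
    then show False
      using assms(1) by (metis scaleR_one_in_oct_scalars)
  qed
  with eq show "s = s'"
    by (metis add_left_cancel scaleR_oct_one_eq_iff)
qed

lemma oct_cube_scalar: "oct_cube (r *\<^sub>R \<one>\<^sub>O) = r^3 *\<^sub>R \<one>\<^sub>O"
  by (simp add: oct_cube_def oct_mult_def oct_one_def power3_eq_cube)

subsection \<open>Automorphisms\<close>

lemma oct_AutD:
  assumes "f \<in> oct_Aut"
  shows "linear f" "bij f" "f (a \<odot> b) = f a \<odot> f b"
  using assms unfolding oct_Aut_def by blast+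

text \<open>A left inverse gives injectivity; finite dimension then gives bijectivity.\<close>

lemma oct_AutI:
  assumes "linear f" "\<And>a b. f (a \<odot> b) = f a \<odot> f b" "\<And>a. g (f a) = a"
  shows "f \<in> oct_Aut"
proof -
  have "inj f"
    by (metis assms(3) injI)
  with assms(1) have "bij f"
    by (simp add: bij_def linear_injective_imp_surjective)
  with assms show ?thesis
    by (simp add: oct_Aut_def)
qed

lemma oct_Aut_comp:
  assumes "f \<in> oct_Aut" "g \<in> oct_Aut"
  shows "f \<circ> g \<in> oct_Aut"
  using assms by (simp add: oct_Aut_def linear_compose bij_comp del: split_paired_All)

lemma oct_Aut_inv:
  assumes "f \<in> oct_Aut"
  shows "inv f \<in> oct_Aut"
proof -
  note f = oct_AutD[OF assms]
  have inj: "inj f" and surj: "surj f"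
    using f(2) by (auto simp: bij_def)
  have ff: "f (inv f a) = a" for a
    using surj by (simp add: surj_f_inv_f)
  have eqI: "inv f b = a" if "f a = b" for a b
    using that inj by (metis inv_f_f)
  have "linear (inv f)"
    by (rule linearI; rule eqI) (simp_all add: linear_add[OF f(1)] linear_scale[OF f(1)] ff)
  moreover have "inv f (a \<odot> b) = inv f a \<odot> inv f b" for a b
    by (rule eqI) (simp add: f(3) ff)
  ultimately show ?thesis
    using f(2) by (simp add: oct_Aut_def bij_imp_bij_inv)
qed

lemma oct_Aut_one:
  assumes "f \<in> oct_Aut"
  shows "f \<one>\<^sub>O = \<one>\<^sub>O"
proof -
  obtain b where b: "f b = \<one>\<^sub>O"
    using oct_AutD(2)[OF assms] by (metis bij_pointE)
  \<comment> \<open>As \<open>f b\<close> is the unity, this already says that \<open>f\<close>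
    fixes the unity.\<close>
  have "f \<one>\<^sub>O \<odot> f b = f b"
    by (simp flip: oct_AutD(3)[OF assms])
  then show ?thesis
    by (simp add: b)
qed

lemma oct_Aut_affine:
  assumes "f \<in> oct_Aut"
  shows "f (r *\<^sub>R a + s *\<^sub>R \<one>\<^sub>O) = r *\<^sub>R f a + s *\<^sub>R \<one>\<^sub>O"
  using oct_AutD(1)[OF assms] by (simp add: linear_add linear_scale oct_Aut_one[OF assms])

lemma oct_Aut_scalar:
  assumes "f \<in> oct_Aut"
  shows "f (s *\<^sub>R \<one>\<^sub>O) = s *\<^sub>R \<one>\<^sub>O"
  using oct_Aut_affine[OF assms, of 0 0 s] by simp

lemma oct_Aut_scalars_iff:
  assumes "f \<in> oct_Aut"
  shows "f a \<in> oct_scalars \<longleftrightarrow> a \<in> oct_scalars"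
proof -
  have "inj f"
    using oct_AutD(2)[OF assms] by (simp add: bij_def)
  then show ?thesis
    unfolding oct_scalars_iff by (metis oct_Aut_scalar[OF assms] inj_eq)
qed

text \<open>Off the scalars, trace and norm are determined by the quadratic equation of an element.\<close>

lemma oct_Aut_tr_norm:
  assumes f: "f \<in> oct_Aut"
  shows "oct_tr (f a) = oct_tr a" and "oct_norm (f a) = oct_norm a"
proof -
  have "oct_tr (f a) = oct_tr a \<and> oct_norm (f a) = oct_norm a"
  proof (cases "a \<in> oct_scalars")
    case True
    then show ?thesis
      using oct_Aut_scalar[OF f] by (auto simp: oct_scalars_iff)
  next
    case False
    then have fa: "f a \<notin> oct_scalars"
      by (simp add: oct_Aut_scalars_iff[OF f])
    have "f (a \<odot> a) = f a \<odot> f a"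
      by (rule oct_AutD(3)[OF f])
    then have "oct_tr a *\<^sub>R f a + (- oct_norm a) *\<^sub>R \<one>\<^sub>O
        = oct_tr (f a) *\<^sub>R f a + (- oct_norm (f a)) *\<^sub>R \<one>\<^sub>O"
      by (simp only: oct_square oct_Aut_affine[OF f])
    from oct_affine_unique[OF fa this] show ?thesis
      by simp
  qed
  then show "oct_tr (f a) = oct_tr a" and "oct_norm (f a) = oct_norm a"
    by auto
qed

section \<open>Orbits as classes of an equivalence relation\<close>

definition oct_similar :: "split_octonion \<Rightarrow> split_octonion \<Rightarrow> bool"
  where "oct_similar a b \<longleftrightarrow> (\<exists>f\<in>oct_Aut. f a = b)"

lemma oct_similarI: "f \<in> oct_Aut \<Longrightarrow> f a = b \<Longrightarrow> oct_similar a b"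
  by (auto simp: oct_similar_def)

lemma oct_similar_trans [trans]: "oct_similar a b \<Longrightarrow> oct_similar b d \<Longrightarrow> oct_similar a d"
  unfolding oct_similar_def by (metis oct_Aut_comp comp_apply)

lemma oct_similar_sym: "oct_similar a b \<Longrightarrow> oct_similar b a"
  unfolding oct_similar_def by (metis oct_Aut_inv oct_AutD(2) bij_def inv_f_f)

lemma oct_similar_refl: "oct_similar a a"
proof (rule oct_similarI)
  show "id \<in> oct_Aut"
    by (simp add: oct_Aut_def linear_id)
qed simp

lemma oct_similar_tr_norm:
  assumes "oct_similar a b"
  shows "oct_tr b = oct_tr a" "oct_norm b = oct_norm a" "b \<in> oct_scalars \<longleftrightarrow> a \<in> oct_scalars"
  using assms by (auto simp: oct_similar_def oct_Aut_tr_norm oct_Aut_scalars_iff)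

lemma oct_orbit_iff:
  "x \<in> oct_orbit l m \<longleftrightarrow> oct_similar (l, vector [m, 0, 0], vector [1, 0, 0], 0) x"
  by (auto simp: oct_orbit_def oct_similar_def)

section \<open>Explicit automorphisms: swap, shears, action of SL3\<close>

definition oct_swap :: "split_octonion \<Rightarrow> split_octonion"
  where "oct_swap a = (case a of (\<alpha>, u, v, \<beta>) \<Rightarrow> (\<beta>, - v, - u, \<alpha>))"

lemma oct_swap_Aut: "oct_swap \<in> oct_Aut"
proof (rule oct_AutI)
  show "linear oct_swap"
    by (rule linearI) (auto simp: oct_swap_def split: prod.splits)
  \<comment> \<open>The minus signs in the swap compensate the opposite signs of the two cross
    products.\<close>
  show "oct_swap (a \<odot> b) = oct_swap a \<odot> oct_swap b" for a b
    by (cases a; cases b) (simp add: oct_swap_def oct_mult_def inner_commute algebra_simps)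
  show "oct_swap (oct_swap a) = a" for a
    by (simp add: oct_swap_def split: prod.splits)
qed

text \<open>The exponential of the nilpotent derivation
  \<open>(\<alpha>, u, v, \<beta>) \<mapsto> (- w \<bullet> v, (\<alpha> - \<beta>) w, - u \<times> w, w \<bullet> v)\<close>.\<close>

definition oct_shear :: "real^3 \<Rightarrow> split_octonion \<Rightarrow> split_octonion"
  where "oct_shear w a = (case a of (\<alpha>, u, v, \<beta>) \<Rightarrow>
    (\<alpha> - w \<bullet> v, u + (\<alpha> - \<beta> - w \<bullet> v) *\<^sub>R w, v - u \<times> w, \<beta> + w \<bullet> v))"

text \<open>The derivation has third power zero, and half its square contributes only
  \<open>- (w \<bullet> v) *\<^sub>R w\<close> to the upper entry. In coordinates, multiplicativity
  is a polynomial identity.\<close>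

lemma oct_shear_Aut: "oct_shear w \<in> oct_Aut"
proof (rule oct_AutI)
  show "linear (oct_shear w)"
    by (rule linearI)
      (auto simp: oct_shear_def cross_add_left cross_mult_left inner_add_right scaleR_add_left
        scaleR_diff_left scaleR_add_right scaleR_diff_right distrib_left right_diff_distrib
        split: prod.splits)
  show "oct_shear w (a \<odot> b) = oct_shear w a \<odot> oct_shear w b" for a b
    by (cases a; cases b;
        simp add: oct_shear_def oct_mult_def vec_eq_iff forall_3 inner_vec_def sum_3 cross3_def;
        intro conjI; simp only: ring_distribs; simp add: mult_ac)
  show "oct_shear (- w) (oct_shear w a) = a" for a
    by (cases a)
      (simp add: oct_shear_def cross_add_left cross_mult_left inner_diff_right dot_cross_self
        scaleR_left_diff_distrib scaleR_left_distrib Cross3.left_diff_distrib)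
qed

text \<open>SL3 acts on the two off-diagonal entries by dual representations: \<open>B\<close> is to
  be the inverse transpose of \<open>A\<close>.\<close>

definition oct_linear :: "real^3^3 \<Rightarrow> real^3^3 \<Rightarrow> split_octonion \<Rightarrow> split_octonion"
  where "oct_linear A B a = (case a of (\<alpha>, u, v, \<beta>) \<Rightarrow> (\<alpha>, A *v u, B *v v, \<beta>))"

text \<open>Cross products transform by the cofactor matrix, which is the inverse transpose when the
  determinant is one.\<close>

lemma cross_mult_inverse_transpose:
  fixes A B :: "real^3^3"
  assumes "B ** transpose A = mat 1" "det A = 1"
  shows "(A *v x) \<times> (A *v y) = B *v (x \<times> y)"
proof -
  have "B *v (transpose A *v ((A *v x) \<times> (A *v y))) = B *v (x \<times> y)"
    by (simp only: cross_matrix_mult assms(2)) simp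
  then show ?thesis
    by (simp add: matrix_vector_mul_assoc assms(1) del: transpose_matrix_vector)
qed

text \<open>Being inverse transposes of determinant one, \<open>A\<close> and \<open>B\<close>
  preserve the pairing of upper with lower entries, and each carries cross products to cross
  products under the other.\<close>

lemma oct_linear_Aut:
  assumes AB: "transpose A ** B = mat 1" and "det B = 1"
  shows "oct_linear A B \<in> oct_Aut"
proof (rule oct_AutI)
  have BA: "transpose B ** A = mat 1"
    using AB by (metis matrix_transpose_mul transpose_mat transpose_transpose)
  have AB': "A ** transpose B = mat 1" "B ** transpose A = mat 1"
    using AB BA by (simp_all add: matrix_left_right_inverse)
  have "det A = 1"
    using arg_cong[OF AB, of det] assms(2) by (simp add: det_mul det_transpose det_I)
  then have cA: "(A *v x) \<times> (A *v y) = B *v (x \<times> y)" for x y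
    by (rule cross_mult_inverse_transpose[OF AB'(2)])
  have cB: "(B *v x) \<times> (B *v y) = A *v (x \<times> y)" for x y
    using AB'(1) assms(2) by (rule cross_mult_inverse_transpose)
  have i1: "(A *v x) \<bullet> (B *v y) = x \<bullet> y" for x y
    by (metis AB dot_lmul_matrix matrix_vector_mul_assoc matrix_vector_mul_lid transpose_matrix_vector transpose_transpose)
  have i2: "(B *v x) \<bullet> (A *v y) = x \<bullet> y" for x y
    using i1[of y x] by (simp add: inner_commute)
  show "linear (oct_linear A B)"
    by (rule linearI)
      (auto simp: oct_linear_def matrix_vector_right_distrib matrix_vector_mult_scaleR split: prod.splits)
  show "oct_linear A B (a \<odot> b) = oct_linear A B a \<odot> oct_linear A B b" for a b
    by (cases a; cases b)
      (simp add: oct_linear_def oct_mult_def cA cB i1 i2 matrix_vector_right_distrib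
        matrix_vector_mult_diff_distrib matrix_vector_mult_scaleR)
  show "oct_linear (transpose B) (transpose A) (oct_linear A B a) = a" for a
    by (cases a) (simp add: oct_linear_def matrix_vector_mul_assoc AB BA del: transpose_matrix_vector)
qed

subsection \<open>Orbits of non-scalar elements\<close>

lemma oct_similar_lower_nonzero:
  assumes "a \<notin> oct_scalars"
  shows "\<exists>\<alpha> u v \<beta>. oct_similar a (\<alpha>, u, v, \<beta>) \<and> v \<noteq> 0"
proof -
  obtain \<alpha> u v \<beta> where a: "a = (\<alpha>, u, v, \<beta>)"
    by (cases a)
  consider "v \<noteq> 0" | "u \<noteq> 0" | "u = 0" "v = 0" "\<alpha> \<noteq> \<beta>"
    using assms unfolding a oct_scalars_iff oct_one_def by auto
  then show ?thesis
  proof cases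
    case 1
    then show ?thesis
      using oct_similar_refl a by blast
  next
    case 2
    have "oct_similar a (\<beta>, - v, - u, \<alpha>)"
      by (rule oct_similarI[OF oct_swap_Aut]) (simp add: a oct_swap_def)
    with 2 show ?thesis
      by (metis neg_equal_0_iff_equal)
  next
    case 3
    \<comment> \<open>For a diagonal element the shear creates the upper entry
      \<open>(\<alpha> - \<beta>) *\<^sub>R axis 1 1\<close>, which the swap moves down.\<close>
    have "(axis 1 1 :: real^3) \<noteq> 0"
      by (simp add: axis_eq_0_iff)
    moreover have "oct_similar a (\<beta>, 0, - ((\<alpha> - \<beta>) *\<^sub>R axis 1 1), \<alpha>)"
      by (rule oct_similarI[OF oct_Aut_comp[OF oct_swap_Aut oct_shear_Aut[of "axis 1 1"]]])
        (simp add: a 3 oct_swap_def oct_shear_def)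
    ultimately show ?thesis
      using 3(3) by (metis neg_equal_0_iff_equal right_minus_eq scaleR_eq_0_iff)
  qed
qed

lemma oct_similar_corner_zero:
  assumes "v \<noteq> 0"
  shows "\<exists>\<alpha>' u' v'. oct_similar (\<alpha>, u, v, \<beta>) (\<alpha>', u', v', 0) \<and> v' \<noteq> 0"
proof (cases "\<beta> = 0")
  case True
  then show ?thesis
    using assms oct_similar_refl by blast
next
  case False
  \<comment> \<open>The shear adds \<open>w \<bullet> v\<close> to the lower corner, so
    \<open>w\<close> is the multiple of \<open>v\<close> that cancels
    \<open>\<beta>\<close>.\<close>
  define w where "w = - (\<beta> / (v \<bullet> v)) *\<^sub>R v"
  have wv: "w \<bullet> v = - \<beta>"
    using assms by (simp add: w_def)
  \<comment> \<open>The new lower entry has the same product with \<open>w\<close> as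
    \<open>v\<close>, hence it cannot vanish.\<close>
  have "w \<bullet> (v - u \<times> w) = - \<beta>"
    by (simp add: inner_diff_right dot_cross_self wv)
  then have "v - u \<times> w \<noteq> 0"
    using False by (metis inner_zero_right neg_equal_0_iff_equal)
  moreover have "oct_similar (\<alpha>, u, v, \<beta>) (\<alpha> + \<beta>, u + \<alpha> *\<^sub>R w, v - u \<times> w, 0)"
    by (rule oct_similarI[OF oct_shear_Aut[of w]]) (simp add: oct_shear_def wv)
  ultimately show ?thesis
    by blast
qed

text \<open>A rotation takes \<open>v\<close> to the first axis; a diagonal matrix of determinant
  one then normalises its length.\<close>

lemma exists_det_one_to_axis:
  fixes v :: "real^3"
  assumes "v \<noteq> 0"
  shows "\<exists>B. det B = 1 \<and> B *v v = vector [1, 0, 0]"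
proof -
  define s where "s = norm v"
  have s: "s \<noteq> 0"
    using assms by (simp add: s_def)
  have "norm v = norm (vector [s, 0, 0] :: real^3)"
    by (simp add: norm_eq_sqrt_inner inner_vec_def sum_3 s_def flip: power2_eq_square)
  then obtain f where f: "orthogonal_transformation f" "det (matrix f) = 1" "f v = vector [s, 0, 0]"
    using rotation_exists[of v "vector [s, 0, 0]"] by auto
  define D :: "real^3^3" where "D = vector [vector [1 / s, 0, 0], vector [0, s, 0], vector [0, 0, 1]]"
  have "det (D ** matrix f) = 1"
    using s by (simp add: det_mul f(2)) (simp add: D_def det_3)
  moreover have "(D ** matrix f) *v v = D *v f v"
    using f(1) by (simp add: matrix_works orthogonal_transformation_linear flip: matrix_vector_mul_assoc)
  moreover have "D *v vector [s, 0, 0] = vector [1, 0, 0]"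
    using s by (simp add: D_def vec_eq_iff forall_3 matrix_vector_mult_def sum_3)
  ultimately show ?thesis
    by (metis f(3))
qed

lemma oct_similar_lower_axis:
  assumes "v \<noteq> 0"
  shows "\<exists>u'. oct_similar (\<alpha>, u, v, \<beta>) (\<alpha>, u', vector [1, 0, 0], \<beta>)"
proof -
  obtain B where B: "det B = 1" "B *v v = vector [1, 0, 0]"
    using exists_det_one_to_axis[OF assms] by blast
  then have "invertible B"
    by (simp add: invertible_det_nz)
  then obtain C where "C ** B = mat 1"
    by (auto simp: invertible_def)
  then have "oct_linear (transpose C) B \<in> oct_Aut"
    by (intro oct_linear_Aut) (simp_all add: transpose_transpose B)
  moreover have "oct_linear (transpose C) B (\<alpha>, u, v, \<beta>)
      = (\<alpha>, transpose C *v u, vector [1, 0, 0], \<beta>)"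
    by (simp add: oct_linear_def B)
  ultimately show ?thesis
    by (blast intro: oct_similarI)
qed

lemma oct_similar_canonical:
  "\<exists>l m. oct_similar (\<alpha>, u, vector [1, 0, 0], 0) (l, vector [m, 0, 0], vector [1, 0, 0], 0)"
proof -
  let ?e = "vector [1, 0, 0] :: real^3"
  define p q r where "p = u $ 1" and "q = u $ 2" and "r = u $ 3"
  have u: "u = vector [p, q, r]"
    by (simp add: vec_eq_iff forall_3 p_def q_def r_def)
  consider "p \<noteq> 0" | "p = 0" "\<alpha> \<noteq> 0" | "p = 0" "\<alpha> = 0"
    by blast
  then show ?thesis
  proof cases
    case 1
    \<comment> \<open>\<open>B\<close> fixes the first axis, and its inverse transpose
      \<open>A\<close> clears the entries \<open>q\<close> and \<open>r\<close> using the pivot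
      \<open>p\<close>.\<close>
    define A B :: "real^3^3"
      where "A = vector [vector [1, 0, 0], vector [- q / p, 1, 0], vector [- r / p, 0, 1]]"
        and "B = vector [vector [1, q / p, r / p], vector [0, 1, 0], vector [0, 0, 1]]"
    have "oct_linear A B \<in> oct_Aut"
    proof (rule oct_linear_Aut)
      show "transpose A ** B = mat 1"
        by (simp add: A_def B_def vec_eq_iff forall_3 matrix_matrix_mult_def transpose_def mat_def sum_3)
      show "det B = 1"
        by (simp add: B_def det_3)
    qed
    moreover have "A *v u = vector [p, 0, 0]" "B *v ?e = ?e"
      using 1 by (simp_all add: A_def B_def u vec_eq_iff forall_3 matrix_vector_mult_def sum_3)
    then have "oct_linear A B (\<alpha>, u, ?e, 0) = (\<alpha>, vector [p, 0, 0], ?e, 0)"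
      by (simp add: oct_linear_def)
    ultimately show ?thesis
      by (blast intro: oct_similarI)
  next
    case 2
    \<comment> \<open>Since \<open>p = 0\<close>, \<open>u\<close> is orthogonal to
      \<open>?e\<close>: the shear removes \<open>u\<close> and leaves the rest unchanged.\<close>
    have "oct_shear (- (1 / \<alpha>) *\<^sub>R u) (\<alpha>, u, ?e, 0) = (\<alpha>, vector [0, 0, 0], ?e, 0)"
      using 2 by (simp add: oct_shear_def u cross_mult_right cross_minus_right)
        (simp add: vec_eq_iff forall_3 inner_vec_def sum_3)
    then show ?thesis
      by (blast intro: oct_similarI oct_shear_Aut)
  next
    case 3
    \<comment> \<open>Conjugation by the swap yields a shear that acts on the upper entry through a
      cross product. The parameter is orthogonal to \<open>u\<close>, and the cross product of
      \<open>?e\<close> with it is \<open>u\<close>.\<close>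
    let ?f = "oct_swap \<circ> (oct_shear (vector [0, r, - q]) \<circ> oct_swap)"
    have "?f (\<alpha>, u, ?e, 0) = (\<alpha>, vector [0, 0, 0], ?e, 0)"
      using 3 by (simp add: oct_swap_def oct_shear_def u vec_eq_iff forall_3 inner_vec_def sum_3 cross3_def)
    then show ?thesis
      by (blast intro: oct_similarI oct_shear_Aut oct_swap_Aut oct_Aut_comp)
  qed
qed

text \<open>Trace, norm and being scalar are invariants. Conversely, the four reductions reach a
  normal form whose parameters are read off from trace and norm.\<close>

theorem oct_orbit_eq:
  "oct_orbit l m = {x. x \<notin> oct_scalars \<and> oct_tr x = l \<and> oct_norm x = - m}"
proof -
  let ?y = "\<lambda>l m. (l, vector [m, 0, 0], vector [1, 0, 0], 0) :: split_octonion"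
  have y: "?y l m \<notin> oct_scalars" "oct_tr (?y l m) = l" "oct_norm (?y l m) = - m" for l m
    by (auto simp: oct_scalars_iff oct_one_def oct_tr_def oct_norm_def vec_eq_iff forall_3
        inner_vec_def sum_3)
  have "oct_similar (?y l m) x" if x: "x \<notin> oct_scalars" "oct_tr x = l" "oct_norm x = - m" for x
  proof -
    obtain \<alpha> u v \<beta> where 1: "oct_similar x (\<alpha>, u, v, \<beta>)" "v \<noteq> 0"
      using oct_similar_lower_nonzero[OF x(1)] by blast
    obtain \<alpha>' u' v' where 2: "oct_similar (\<alpha>, u, v, \<beta>) (\<alpha>', u', v', 0)" "v' \<noteq> 0"
      using oct_similar_corner_zero[OF 1(2)] by blast
    obtain u'' where 3: "oct_similar (\<alpha>', u', v', 0) (\<alpha>', u'', vector [1, 0, 0], 0)"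
      using oct_similar_lower_axis[OF 2(2)] by blast
    obtain l' m' where 4: "oct_similar (\<alpha>', u'', vector [1, 0, 0], 0) (?y l' m')"
      using oct_similar_canonical by blast
    note 1(1)
    also note 2(1)
    also note 3
    also note 4
    finally have *: "oct_similar x (?y l' m')" .
    have "l' = l" "m' = m"
      using oct_similar_tr_norm(1,2)[OF *] y(2,3)[of l' m'] x(2,3) by simp_all
    with * show ?thesis
      by (simp add: oct_similar_sym)
  qed
  moreover have "x \<notin> oct_scalars \<and> oct_tr x = l \<and> oct_norm x = - m"
    if "oct_similar (?y l m) x" for x
    using oct_similar_tr_norm[OF that] y[of l m] by simp
  ultimately show ?thesis
    unfolding oct_orbit_iff[symmetric] by blast
qed

subsection \<open>Cube roots\<close>

lemma root_3_power: "root 3 x ^ 3 = x"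
  by (simp add: odd_real_root_pow)

lemma root_3_unique: "y ^ 3 = x \<Longrightarrow> root 3 x = y"
  by (auto simp: odd_real_root_power_cancel)

text \<open>On scalars, cubing is real cubing. For non-scalar \<open>x\<close> the coefficient of
  \<open>x\<close> in \<open>oct_cube_eq\<close> must vanish, so n(x) = tr(x)^2 and - tr(x)^3 =
  \<gamma>; these values describe an orbit.\<close>

lemma oct_cube_roots_scalar:
  "{x. oct_cube x = \<gamma> *\<^sub>R \<one>\<^sub>O}
    = {root 3 \<gamma> *\<^sub>R \<one>\<^sub>O} \<union> oct_orbit (- root 3 \<gamma>) (- root 3 (\<gamma>\<^sup>2))"
proof -
  have r2: "root 3 (\<gamma>\<^sup>2) = (root 3 \<gamma>)\<^sup>2"
    by (rule root_3_unique) (metis power_mult mult.commute root_3_power)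
  have "oct_cube x = \<gamma> *\<^sub>R \<one>\<^sub>O \<longleftrightarrow> x = root 3 \<gamma> *\<^sub>R \<one>\<^sub>O" if "x \<in> oct_scalars" for x
    using that root_3_unique root_3_power by (auto simp: oct_scalars_iff oct_cube_scalar)
  moreover have "oct_cube x = \<gamma> *\<^sub>R \<one>\<^sub>O \<longleftrightarrow> oct_tr x = - root 3 \<gamma> \<and> oct_norm x = (root 3 \<gamma>)\<^sup>2"
    if x: "x \<notin> oct_scalars" for x
  proof
    assume "oct_cube x = \<gamma> *\<^sub>R \<one>\<^sub>O"
    then have "((oct_tr x)\<^sup>2 - oct_norm x) *\<^sub>R x + (- (oct_tr x * oct_norm x)) *\<^sub>R \<one>\<^sub>O
        = 0 *\<^sub>R x + \<gamma> *\<^sub>R \<one>\<^sub>O"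
      by (simp only: oct_cube_eq) simp
    note eq = oct_affine_unique[OF x this]
    then have "(- oct_tr x) ^ 3 = \<gamma>"
      by (auto simp: power3_eq_cube power2_eq_square)
    with eq(1) show "oct_tr x = - root 3 \<gamma> \<and> oct_norm x = (root 3 \<gamma>)\<^sup>2"
      using root_3_unique[of "- oct_tr x" \<gamma>] by simp
  next
    assume "oct_tr x = - root 3 \<gamma> \<and> oct_norm x = (root 3 \<gamma>)\<^sup>2"
    then show "oct_cube x = \<gamma> *\<^sub>R \<one>\<^sub>O"
      using root_3_power[of \<gamma>] by (simp add: oct_cube_eq power3_eq_cube power2_eq_square)
  qed
  ultimately have "oct_cube x = \<gamma> *\<^sub>R \<one>\<^sub>O \<longleftrightarrow> x = root 3 \<gamma> *\<^sub>R \<one>\<^sub>O \<or>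
      x \<notin> oct_scalars \<and> oct_tr x = - root 3 \<gamma> \<and> oct_norm x = (root 3 \<gamma>)\<^sup>2" for x
    by (metis scaleR_one_in_oct_scalars)
  then show ?thesis
    unfolding oct_orbit_eq r2 by (simp add: set_eq_iff del: split_paired_All)
qed

text \<open>The equation \<open>n(x)\<^sup>3 = n(c)\<close> turns into the polynomial equation for \<open>\<lambda> = tr(x)\<close>, because
  \<open>(2s + T)\<^sup>2 (s - 4T) + 27 s T\<^sup>2 = 4 (s - T)\<^sup>3\<close> and \<open>s - T = 3 \<lambda> n(x)\<close> for \<open>s = \<lambda>\<^sup>3\<close>, \<open>T = tr(c)\<close>.\<close>

lemma oct_cube_root_iff:
  fixes c x :: split_octonion
  defines "T \<equiv> oct_tr c" and "N \<equiv> oct_norm c"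
  assumes c: "c \<notin> oct_scalars" and T: "T \<noteq> 0"
  shows "oct_cube x = c \<longleftrightarrow>
    (\<exists>l. (2 * l^3 + T)\<^sup>2 * (l^3 - 4 * T) = 27 * l^3 * (4 * N - T\<^sup>2) \<and> 2 * l^3 + T \<noteq> 0 \<and>
      x = (3 * l / (2 * l^3 + T)) *\<^sub>R (c - (T / 2) *\<^sub>R \<one>\<^sub>O) + (l / 2) *\<^sub>R \<one>\<^sub>O)"
    (is "_ \<longleftrightarrow> (\<exists>l. ?P l)")
proof
  assume x: "oct_cube x = c"
  define l n where "l = oct_tr x" and "n = oct_norm x"
  have Tl: "T = l^3 - 3 * l * n"
    using oct_tr_cube[of x] by (simp add: x T_def l_def n_def)
  have Nn: "N = n^3"
    using oct_norm_cube[of x] by (simp add: x N_def n_def)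
  have l0: "l \<noteq> 0"
    using T Tl by auto
  have cx: "c = (l\<^sup>2 - n) *\<^sub>R x + (- (l * n)) *\<^sub>R \<one>\<^sub>O"
    using oct_cube_eq[of x] by (simp add: x l_def n_def)
  \<comment> \<open>Otherwise \<open>c\<close> would be scalar.\<close>
  have k0: "l\<^sup>2 - n \<noteq> 0"
    using c cx by (metis add_0 scaleR_one_in_oct_scalars scaleR_zero_left)
  have k: "2 * l^3 + T = 3 * l * (l\<^sup>2 - n)"
    unfolding Tl by algebra
  have "(2 * l^3 + T)\<^sup>2 * (l^3 - 4 * T) = 27 * l^3 * (4 * N - T\<^sup>2)"
    unfolding Tl Nn by algebra
  moreover have "2 * l^3 + T \<noteq> 0"
    using k k0 l0 by simp
  moreover have "(3 * l / (2 * l^3 + T)) *\<^sub>R (c - (T / 2) *\<^sub>R \<one>\<^sub>O) + (l / 2) *\<^sub>R \<one>\<^sub>O = x"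
  proof -
    have e: "3 * l / (2 * l^3 + T) = 1 / (l\<^sup>2 - n)"
      using k k0 l0 by simp
    have "c - (T / 2) *\<^sub>R \<one>\<^sub>O = (l\<^sup>2 - n) *\<^sub>R (x - (l / 2) *\<^sub>R \<one>\<^sub>O)"
    proof -
      have "c - (T / 2) *\<^sub>R \<one>\<^sub>O = (l\<^sup>2 - n) *\<^sub>R x + (- (l * n) - T / 2) *\<^sub>R \<one>\<^sub>O"
        unfolding cx by (simp add: scaleR_diff_left)
      also have "- (l * n) - T / 2 = - ((l\<^sup>2 - n) * (l / 2))"
        unfolding Tl by (simp add: field_simps power2_eq_square power3_eq_cube)
      finally show ?thesis
        by (simp add: scaleR_diff_right)
    qed
    then show ?thesis
      using k0 by (simp add: e)
  qed
  ultimately show "\<exists>l. ?P l"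
    by blast
next
  assume "\<exists>l. ?P l"
  then obtain l where eq: "(2 * l^3 + T)\<^sup>2 * (l^3 - 4 * T) = 27 * l^3 * (4 * N - T\<^sup>2)"
    and k0: "2 * l^3 + T \<noteq> 0"
    and x: "x = (3 * l / (2 * l^3 + T)) *\<^sub>R (c - (T / 2) *\<^sub>R \<one>\<^sub>O) + (l / 2) *\<^sub>R \<one>\<^sub>O"
    by blast
  \<comment> \<open>At \<open>l = 0\<close> the equation would read
    \<open>- 4 * T^3 = 0\<close>.\<close>
  have l0: "l \<noteq> 0"
    using eq T by (auto simp: power2_eq_square)
  \<comment> \<open>\<open>k\<close> will turn out to be the inverse of
    \<open>l\<^sup>2 - oct_norm x\<close>, the coefficient of \<open>x\<close> in its cube.\<close>
  define k where "k = 3 * l / (2 * l^3 + T)"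
  have kk: "k * (2 * l^3 + T) = 3 * l"
    using k0 by (simp add: k_def)
  have x': "x = k *\<^sub>R c + (l / 2 - k * T / 2) *\<^sub>R \<one>\<^sub>O"
    unfolding x k_def[symmetric] by (simp add: algebra_simps)
  have tr: "oct_tr x = l"
    by (simp add: x' T_def)
  have nx: "oct_norm x = k\<^sup>2 * N + k * (l / 2 - k * T / 2) * T + (l / 2 - k * T / 2)\<^sup>2"
    unfolding x' oct_norm_affine by (simp add: N_def T_def)
  have "27 * l^3 * (k\<^sup>2 * (4 * N - T\<^sup>2)) = (k * (2 * l^3 + T))\<^sup>2 * (l^3 - 4 * T)"
  proof -
    have "27 * l^3 * (k\<^sup>2 * (4 * N - T\<^sup>2)) = k\<^sup>2 * (27 * l^3 * (4 * N - T\<^sup>2))"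
      by simp
    then show ?thesis
      unfolding eq[symmetric] by (simp add: power_mult_distrib)
  qed
  also have "\<dots> = 9 * l\<^sup>2 * (l^3 - 4 * T)"
    by (simp add: kk power_mult_distrib)
  finally have e: "27 * l^3 * (k\<^sup>2 * (4 * N - T\<^sup>2)) = 9 * l\<^sup>2 * (l^3 - 4 * T)" .
  \<comment> \<open>The discriminant 4 n - tr^2 ignores added scalars and scales
    quadratically.\<close>
  have "k\<^sup>2 * (4 * N - T\<^sup>2) = 4 * oct_norm x - l\<^sup>2"
    unfolding nx by (simp add: field_simps power2_eq_square)
  with e have "27 * l^3 * (4 * oct_norm x - l\<^sup>2) = 9 * l\<^sup>2 * (l^3 - 4 * T)"
    by simp
  then have "9 * l\<^sup>2 * (3 * l * (4 * oct_norm x - l\<^sup>2)) = 9 * l\<^sup>2 * (l^3 - 4 * T)"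
    by (simp add: power3_eq_cube power2_eq_square mult_ac)
  then have "3 * l * (4 * oct_norm x - l\<^sup>2) = l^3 - 4 * T"
    using l0 by simp
  \<comment> \<open>This is the trace of the desired equation; with \<open>kk\<close> it gives both
    coefficients of the cube.\<close>
  then have n: "3 * l * oct_norm x = l^3 - T"
    by algebra
  have "3 * l * (k * (l\<^sup>2 - oct_norm x)) = 3 * l * 1"
    using n kk by algebra
  then have kn: "k * (l\<^sup>2 - oct_norm x) = 1"
    using l0 by (simp only: mult_cancel_left) simp
  have "2 * (l\<^sup>2 - oct_norm x) * (l / 2 - k * T / 2) = 2 * (l * oct_norm x)"
    using n kn by algebra
  then have s: "(l\<^sup>2 - oct_norm x) * (l / 2 - k * T / 2) = l * oct_norm x"
    by (simp only: mult.assoc mult_cancel_left) simp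
  have "oct_cube x = (l\<^sup>2 - oct_norm x) *\<^sub>R (k *\<^sub>R c + (l / 2 - k * T / 2) *\<^sub>R \<one>\<^sub>O)
      + (- (l * oct_norm x)) *\<^sub>R \<one>\<^sub>O"
    unfolding oct_cube_eq tr x'[symmetric] ..
  also have "\<dots> = ((l\<^sup>2 - oct_norm x) * k) *\<^sub>R c
      + ((l\<^sup>2 - oct_norm x) * (l / 2 - k * T / 2)) *\<^sub>R \<one>\<^sub>O + (- (l * oct_norm x)) *\<^sub>R \<one>\<^sub>O"
    by (simp only: scaleR_add_right scaleR_scaleR)
  also have "\<dots> = c"
    unfolding s using kn by (simp add: mult.commute)
  finally show "oct_cube x = c" .
qed

section \<open>Cube roots of non-scalar elements of trace zero\<close>

lemma oct_cube_root_traceless: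
  assumes x: "oct_cube x = c" and c: "c \<notin> oct_scalars" "oct_tr c = 0"
  defines "R \<equiv> root 3 (oct_norm c)"
  shows "R \<noteq> 0" and "oct_tr x = 0 \<and> x = - (1 / R) *\<^sub>R c \<or>
    (oct_tr x)\<^sup>2 = 3 * R \<and> x = (1/2) *\<^sub>R ((1 / R) *\<^sub>R c + oct_tr x *\<^sub>R \<one>\<^sub>O)"
proof -
  have n: "oct_norm x = R"
    unfolding R_def using oct_norm_cube[of x] root_3_unique x by simp
  have cx: "c = ((oct_tr x)\<^sup>2 - R) *\<^sub>R x + (- (oct_tr x * R)) *\<^sub>R \<one>\<^sub>O"
    using oct_cube_eq[of x] by (simp add: x n)
  have k: "(oct_tr x)\<^sup>2 \<noteq> R"
    using c(1) cx by (metis add_0 diff_self scaleR_one_in_oct_scalars scaleR_zero_left)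
  \<comment> \<open>The vanishing trace of the cube factors; each factor makes \<open>cx\<close> an
    explicit linear equation for \<open>x\<close>.\<close>
  have "oct_tr x * ((oct_tr x)\<^sup>2 - 3 * R) = 0"
    using oct_tr_cube[of x] unfolding x n c(2) by algebra
  then have t: "oct_tr x = 0 \<or> (oct_tr x)\<^sup>2 = 3 * R"
    by auto
  \<comment> \<open>If \<open>R = 0\<close>, both alternatives give trace zero and contradict
    \<open>k\<close>. This settles the case of norm zero.\<close>
  with k show R0: "R \<noteq> 0"
    by auto
  from t show "oct_tr x = 0 \<and> x = - (1 / R) *\<^sub>R c \<or>
    (oct_tr x)\<^sup>2 = 3 * R \<and> x = (1/2) *\<^sub>R ((1 / R) *\<^sub>R c + oct_tr x *\<^sub>R \<one>\<^sub>O)"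
  proof
    assume "oct_tr x = 0"
    then have "c = (- R) *\<^sub>R x"
      using cx by simp
    with \<open>oct_tr x = 0\<close> R0 show ?thesis
      by simp
  next
    assume t2: "(oct_tr x)\<^sup>2 = 3 * R"
    have "c = R *\<^sub>R (2 *\<^sub>R x - oct_tr x *\<^sub>R \<one>\<^sub>O)"
      using cx by (simp add: t2 scaleR_diff_right mult.commute)
    then have "(1 / R) *\<^sub>R c = 2 *\<^sub>R x - oct_tr x *\<^sub>R \<one>\<^sub>O"
      using R0 by simp
    with t2 show ?thesis
      by simp
  qed
qed

text \<open>The candidate has trace 0 and norm \<open>R\<close>, so cubing multiplies it by
  \<open>- R\<close>.\<close>

lemma oct_cube_traceless_scaled:
  assumes "oct_tr c = 0" "oct_norm c \<noteq> 0"
  shows "oct_cube (- (1 / root 3 (oct_norm c)) *\<^sub>R c) = c"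
proof -
  define R where "R = root 3 (oct_norm c)"
  have R: "oct_norm c = R^3" "R \<noteq> 0"
    using assms(2) by (simp_all add: R_def root_3_power)
  have "oct_norm (- (1 / R) *\<^sub>R c) = R"
    using oct_norm_affine[of "- (1 / R)" c 0] R assms(1)
    by (simp add: power2_eq_square power3_eq_cube)
  moreover have "oct_tr (- (1 / R) *\<^sub>R c) = 0"
    by (simp only: oct_tr_scaleR assms(1))
  ultimately show ?thesis
    unfolding R_def[symmetric] oct_cube_eq using R(2) by simp
qed

text \<open>The candidate has norm R/4 + t^2/4 = R. Only \<open>t\<^sup>2\<close> is prescribed, so
  both signs of \<open>t\<close> give roots.\<close>

lemma oct_cube_traceless_shifted:
  assumes "oct_tr c = 0" "oct_norm c \<noteq> 0" "t\<^sup>2 = 3 * root 3 (oct_norm c)"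
  shows "oct_cube ((1/2) *\<^sub>R ((1 / root 3 (oct_norm c)) *\<^sub>R c + t *\<^sub>R \<one>\<^sub>O)) = c"
proof -
  define R where "R = root 3 (oct_norm c)"
  have R: "oct_norm c = R^3" "R \<noteq> 0" "t\<^sup>2 = 3 * R"
    using assms by (simp_all add: R_def root_3_power)
  define x where "x = (1/2) *\<^sub>R ((1 / R) *\<^sub>R c + t *\<^sub>R \<one>\<^sub>O)"
  have x: "x = (1 / (2 * R)) *\<^sub>R c + (t / 2) *\<^sub>R \<one>\<^sub>O"
    by (simp add: x_def scaleR_add_right)
  have tr: "oct_tr x = t"
    by (simp add: x assms(1))
  have n: "oct_norm x = R"
    unfolding x oct_norm_affine using R assms(1)
    by (simp add: power_divide power_mult_distrib) (simp add: power2_eq_square power3_eq_cube)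
  have "oct_cube x = (2 * R) *\<^sub>R x + (- (t * R)) *\<^sub>R \<one>\<^sub>O"
    by (simp add: oct_cube_eq tr n R)
  also have "\<dots> = c"
    using R(2) by (simp add: x scaleR_add_right)
  finally show ?thesis
    unfolding x_def R_def .
qed

lemma root_6_square:
  assumes "x \<ge> 0"
  shows "(root 6 x)\<^sup>2 = root 3 x"
proof -
  have "((root 6 x)\<^sup>2)^3 = x"
    using assms by (simp flip: power_mult)
  then show ?thesis
    using root_3_unique by metis
qed

text \<open>For trace zero and positive norm the list includes \<open>x3\<close>, the root with the
  other sign of the square root; \<open>oct_third_cube_root\<close> shows that \<open>x1\<close> and
  \<open>x2\<close> alone do not suffice.\<close>

theorem proposition4p4:
  fixes c x1 x2 x3 :: split_octonion and X :: "split_octonion set"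
  defines "X \<equiv> {x. oct_cube x = c}"
    and "x1 \<equiv> - (1 / root 3 (oct_norm c)) *\<^sub>R c"
    and "x2 \<equiv> (1/2) *\<^sub>R ((1 / root 3 (oct_norm c)) *\<^sub>R c + (sqrt 3 * root 6 (oct_norm c)) *\<^sub>R \<one>\<^sub>O)"
    and "x3 \<equiv> (1/2) *\<^sub>R ((1 / root 3 (oct_norm c)) *\<^sub>R c - (sqrt 3 * root 6 (oct_norm c)) *\<^sub>R \<one>\<^sub>O)"
  shows "(\<forall>\<gamma>::real. c = \<gamma> *\<^sub>R \<one>\<^sub>O \<longrightarrow>
           X = {root 3 \<gamma> *\<^sub>R \<one>\<^sub>O} \<union> oct_orbit (- root 3 \<gamma>) (- root 3 (\<gamma>^2)))
       \<and> (c \<notin> oct_scalars \<and> oct_tr c \<noteq> 0 \<longrightarrow>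
           (\<forall>x. x \<in> X \<longleftrightarrow>
             (\<exists>lam::real.
               (2 * lam^3 + oct_tr c)^2 * (lam^3 - 4 * oct_tr c)
                 = 27 * lam^3 * (4 * oct_norm c - (oct_tr c)^2)
               \<and> 2 * lam^3 + oct_tr c \<noteq> 0
               \<and> x = (3 * lam / (2 * lam^3 + oct_tr c)) *\<^sub>R (c - (oct_tr c / 2) *\<^sub>R \<one>\<^sub>O)
                     + (lam / 2) *\<^sub>R \<one>\<^sub>O)))
       \<and> (c \<notin> oct_scalars \<and> oct_tr c = 0 \<longrightarrow>
           (oct_norm c > 0 \<longrightarrow> X = {x1, x2, x3})
         \<and> (oct_norm c = 0 \<longrightarrow> X = {})
         \<and> (oct_norm c < 0 \<longrightarrow> X = {x1}))"
proof (intro conjI allI impI; (elim conjE)?)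
  fix \<gamma> :: real
  assume "c = \<gamma> *\<^sub>R \<one>\<^sub>O"
  then show "X = {root 3 \<gamma> *\<^sub>R \<one>\<^sub>O} \<union> oct_orbit (- root 3 \<gamma>) (- root 3 (\<gamma>^2))"
    by (simp only: X_def oct_cube_roots_scalar)
next
  fix x
  assume "c \<notin> oct_scalars" "oct_tr c \<noteq> 0"
  then show "x \<in> X \<longleftrightarrow>
             (\<exists>lam::real.
               (2 * lam^3 + oct_tr c)^2 * (lam^3 - 4 * oct_tr c)
                 = 27 * lam^3 * (4 * oct_norm c - (oct_tr c)^2)
               \<and> 2 * lam^3 + oct_tr c \<noteq> 0
               \<and> x = (3 * lam / (2 * lam^3 + oct_tr c)) *\<^sub>R (c - (oct_tr c / 2) *\<^sub>R \<one>\<^sub>O)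
                     + (lam / 2) *\<^sub>R \<one>\<^sub>O)"
    unfolding X_def mem_Collect_eq by (rule oct_cube_root_iff)
next
  assume c: "c \<notin> oct_scalars" "oct_tr c = 0" and n: "oct_norm c > 0"
  define t where "t = sqrt 3 * root 6 (oct_norm c)"
  have t: "t\<^sup>2 = 3 * root 3 (oct_norm c)"
    using n by (simp add: t_def power_mult_distrib root_6_square)
  have "x = x1 \<or> x = x2 \<or> x = x3" if "oct_cube x = c" for x
  proof -
    have "oct_tr x = t \<or> oct_tr x = - t" if "(oct_tr x)\<^sup>2 = 3 * root 3 (oct_norm c)"
      using that t by (metis power2_eq_iff)
    moreover have "x3 = (1/2) *\<^sub>R ((1 / root 3 (oct_norm c)) *\<^sub>R c + (- t) *\<^sub>R \<one>\<^sub>O)"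
      by (simp add: x3_def t_def)
    ultimately show ?thesis
      using oct_cube_root_traceless(2)[OF that c]
      unfolding x1_def x2_def t_def[symmetric] by metis
  qed
  moreover have "oct_cube x1 = c"
    unfolding x1_def using c(2) n by (intro oct_cube_traceless_scaled) auto
  moreover have "oct_cube x2 = c"
    unfolding x2_def t_def[symmetric] using c(2) n t by (intro oct_cube_traceless_shifted) auto
  moreover have "oct_cube x3 = c"
    unfolding x3_def t_def[symmetric] using oct_cube_traceless_shifted[of c "- t"] c(2) n t by simp
  ultimately show "X = {x1, x2, x3}"
    unfolding X_def by blast
next
  assume c: "c \<notin> oct_scalars" "oct_tr c = 0" and n: "oct_norm c = 0"
  have False if "oct_cube x = c" for x
    using oct_cube_root_traceless(1)[OF that c] n by simp
  then show "X = {}"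
    unfolding X_def by blast
next
  assume c: "c \<notin> oct_scalars" "oct_tr c = 0" and n: "oct_norm c < 0"
  have "x = x1" if "oct_cube x = c" for x
  proof -
    \<comment> \<open>A negative \<open>3 * R\<close> is not a real square, so only the root of
      trace zero remains.\<close>
    have "root 3 (oct_norm c) < 0"
      using n by simp
    then have "(oct_tr x)\<^sup>2 \<noteq> 3 * root 3 (oct_norm c)"
      using zero_le_power2[of "oct_tr x"] by linarith
    then show ?thesis
      using oct_cube_root_traceless(2)[OF that c] unfolding x1_def by blast
  qed
  moreover have "oct_cube x1 = c"
    unfolding x1_def using c(2) n by (intro oct_cube_traceless_scaled) auto
  ultimately show "X = {x1}"
    unfolding X_def by blast
qed

end
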